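(* Let $n\in\{5,6\}$ and $k,\ell\in\mathbb{N}$. If $M\in M_n(A^{\otimes k})$ is a magic unitary whose entries satisfy $M_{ij}\in\langle\mathcal{A}_\ell^{\otimes k}\rangle$ for all $1\le i,j\le n$, then there exists a separating polynomial for $M$, i.e. a non-zero $P\in\mathbb{C}\langle X_n\rangle$ with $P(M)=0$ and $P\notin I_n$.
   Context: $A=C^*(p,q\mid p^2=p^*=p,\ q^2=q^*=q)$ is the universal unital $C^*$-algebra generated by two projections. Let $\mathcal{A}=\{1,p,q,pq,qp,pqp,qpq,\dots\}\subseteq A$ be the set of all alternating products of $p$ and $q$ (including the empty product $1$), $\mathcal{A}_\ell\subseteq\mathcal{A}$ the set of those with at most $\ell$ factors, and $\mathcal{A}_\ell^{\otimes k}=\{a_1\otimes\cdots\otimes a_k: a_1,\dots,a_k\in\mathcal{A}_\ell\}\subseteq A^{\otimes k}$. $\langle\,\cdot\,\rangle$ denotes the complex linear span. A matrix $M\in M_n(D)$ over a unital $C^*$-algebra $D$ is a magic unitary if $M_{ij}^2=M_{ij}^*=M_{ij}$ and $\sum_{r}M_{ir}=1=\sum_r M_{rj}$ for all $1\le i,j\le n$. $\mathbb{C}\langle X_n\rangle$ is the free unital associative algebra on $X_n=\{x_{ij}:1\le i,j\le n\}$, and $P(M)$ is obtained by substituting $M_{ij}$ for $x_{ij}$. The magic unitary ideal $I_n\subseteq\mathbb{C}\langle X_n\rangle$ is the two-sided ideal generated by $x_{ij}^2-x_{ij}$, $\sum_{r=1}^n x_{ir}-1$, $\sum_{r=1}^n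 x_{rj}-1$ for $1\le i,j\le n$, and $x_{ij}x_{ir}$, $x_{ji}x_{ri}$ for $1\le i,j,r\le n$, $j\ne r$. *)

theory Defs
  imports "HOL-Analysis.Analysis" "HOL-Library.Poly_Mapping"
begin

section \<open>Unital C*-algebras\<close>

class scaleC =
  fixes scaleC :: "complex \<Rightarrow> 'a \<Rightarrow> 'a"  (infixr \<open>*\<^sub>C\<close> 75)

class star =
  fixes star :: "'a \<Rightarrow> 'a"

text \<open>
  Non-zero unital complex C*-algebras; the classes extended here supply the unit, the
  submultiplicative norm (with \<open>norm 1 = 1\<close>) and completeness.
\<close>

class cstar_algebra = real_normed_algebra_1 + banach + scaleC + star +
  assumes scaleC_add_right: "a *\<^sub>C (x + y) = a *\<^sub>C x + a *\<^sub>C y"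
    and scaleC_add_left: "(a + b) *\<^sub>C x = a *\<^sub>C x + b *\<^sub>C x"
    and scaleC_scaleC: "a *\<^sub>C b *\<^sub>C x = (a * b) *\<^sub>C x"
    and scaleC_one: "1 *\<^sub>C x = x"
    and scaleR_scaleC: "r *\<^sub>R x = complex_of_real r *\<^sub>C x"
    and mult_scaleC_left: "(a *\<^sub>C x) * y = a *\<^sub>C (x * y)"
    and mult_scaleC_right: "x * (a *\<^sub>C y) = a *\<^sub>C (x * y)"
    and norm_scaleC: "norm (a *\<^sub>C x) = cmod a * norm x"
    and star_star: "star (star x) = x"
    and star_add: "star (x + y) = star x + star y"
    and star_scaleC: "star (a *\<^sub>C x) = cnj a *\<^sub>C star x"
    and star_mult: "star (x * y) = star y * star x"
    and cstar_identity: "norm (star x * x) = (norm x)\<^sup>2"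

global_interpretation cstar_vs:
  vector_space "scaleC :: complex \<Rightarrow> 'a \<Rightarrow> 'a::cstar_algebra"
  by standard (simp_all add: scaleC_add_right scaleC_add_left scaleC_scaleC scaleC_one)

abbreviation cspan :: "'a::cstar_algebra set \<Rightarrow> 'a set"
  where "cspan \<equiv> cstar_vs.span"

abbreviation cindependent :: "'a::cstar_algebra set \<Rightarrow> bool"
  where "cindependent S \<equiv> \<not> cstar_vs.dependent S"

definition is_projection :: "'a::cstar_algebra \<Rightarrow> bool"
  where "is_projection e \<longleftrightarrow> e\<^sup>2 = e \<and> star e = e"


section \<open>Free algebras\<close>

text \<open>
  Lists form the free monoid under concatenation, so the convolution product of finitely
  supported functions makes \<open>'x list \<Rightarrow>\<^sub>0 complex\<close> the free unital associative complex algebra on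
  \<open>'x\<close>.
\<close>

instantiation list :: (type) monoid_add
begin
definition zero_list :: "'a list" where "zero_list = []"
definition plus_list :: "'a list \<Rightarrow> 'a list \<Rightarrow> 'a list" where "plus_list = (@)"
instance by standard (simp_all add: zero_list_def plus_list_def)
end

type_synonym 'x free_algebra = "'x list \<Rightarrow>\<^sub>0 complex"

definition var :: "'x \<Rightarrow> 'x free_algebra"
  where "var x = Poly_Mapping.single [x] 1"

definition scalar :: "complex \<Rightarrow> 'x free_algebra"
  where "scalar c = Poly_Mapping.single [] c"

definition subst :: "('x \<Rightarrow> 'a::cstar_algebra) \<Rightarrow> 'x free_algebra \<Rightarrow> 'a"
  where "subst v f =
    (\<Sum>w\<in>Poly_Mapping.keys f. Poly_Mapping.lookup f w *\<^sub>C prod_list (map v w))"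

definition two_sided_ideal :: "'r::ring_1 set \<Rightarrow> bool"
  where "two_sided_ideal I \<longleftrightarrow>
    0 \<in> I \<and> (\<forall>x\<in>I. \<forall>y\<in>I. x + y \<in> I) \<and> (\<forall>x\<in>I. \<forall>a. a * x \<in> I \<and> x * a \<in> I)"


section \<open>Universal C*-algebras\<close>

text \<open>The free *-algebra on \<open>'x\<close> is the free algebra on the letters \<open>Gen x\<close> and \<open>Adj x\<close>.\<close>

datatype 'x letter = Gen 'x | Adj 'x

type_synonym 'x free_star_algebra = "'x letter free_algebra"

primrec swap_letter :: "'x letter \<Rightarrow> 'x letter" where
  "swap_letter (Gen x) = Adj x"
| "swap_letter (Adj x) = Gen x"

definition free_star :: "'x free_star_algebra \<Rightarrow> 'x free_star_algebra"
  where "free_star f = (\<Sum>w\<in>Poly_Mapping.keys f.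
    Poly_Mapping.single (rev (map swap_letter w)) (cnj (Poly_Mapping.lookup f w)))"

primrec letter_value :: "('x \<Rightarrow> 'a::star) \<Rightarrow> 'x letter \<Rightarrow> 'a" where
  "letter_value v (Gen x) = v x"
| "letter_value v (Adj x) = star (v x)"

definition star_subst :: "('x \<Rightarrow> 'a::cstar_algebra) \<Rightarrow> 'x free_star_algebra \<Rightarrow> 'a"
  where "star_subst v = subst (letter_value v)"

definition cstar_seminorm :: "('x free_star_algebra \<Rightarrow> real) \<Rightarrow> bool"
  where "cstar_seminorm \<sigma> \<longleftrightarrow>
    (\<forall>f. 0 \<le> \<sigma> f) \<and>
    (\<forall>f g. \<sigma> (f + g) \<le> \<sigma> f + \<sigma> g) \<and>
    (\<forall>c f. \<sigma> (scalar c * f) = cmod c * \<sigma> f) \<and>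
    (\<forall>f g. \<sigma> (f * g) \<le> \<sigma> f * \<sigma> g) \<and>
    (\<forall>f. \<sigma> (free_star f * f) = (\<sigma> f)\<^sup>2)"

text \<open>
  The universal C*-algebra \<open>C*('x | r = 0 for r \<in> R)\<close> is the completion of the free *-algebra on
  \<open>'x\<close>, modulo the elements of norm \<open>0\<close>, in the largest C*-seminorm that vanishes on \<open>R\<close>. The
  predicate says that the C*-algebra \<open>'a\<close>, with generators \<open>v x\<close>, is this completion: the
  seminorm \<open>\<lambda>f. norm (star_subst v f)\<close> itself vanishes on \<open>R\<close> and it is the largest one. Using
  seminorms avoids quantifying over all C*-algebras satisfying the relations.
\<close>

definition universal_cstar_algebra ::
    "'x free_star_algebra set \<Rightarrow> ('x \<Rightarrow> 'a::cstar_algebra) \<Rightarrow> bool"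
  where "universal_cstar_algebra R v \<longleftrightarrow>
    (\<forall>r\<in>R. star_subst v r = 0) \<and>
    closure (range (star_subst v)) = UNIV \<and>
    (\<forall>\<sigma> f. cstar_seminorm \<sigma> \<and> (\<forall>r\<in>R. \<sigma> r = 0) \<longrightarrow> \<sigma> f \<le> norm (star_subst v f))"

datatype pq = Gen_p | Gen_q

definition projection_relations :: "pq free_star_algebra set"
  where "projection_relations =
    (\<Union>g. {(var (Gen g))\<^sup>2 - var (Gen g), var (Adj g) - var (Gen g)})"

text \<open>The C*-algebra \<open>'a\<close> is \<open>C*(p, q | p\<^sup>2 = p* = p, q\<^sup>2 = q* = q)\<close>.\<close>

definition universal_two_projections :: "'a::cstar_algebra \<Rightarrow> 'a \<Rightarrow> bool"
  where "universal_two_projections p q \<longleftrightarrow>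
    universal_cstar_algebra projection_relations (case_pq p q)"

definition alternating_products :: "'a::monoid_mult \<Rightarrow> 'a \<Rightarrow> nat \<Rightarrow> 'a set"
  where "alternating_products p q l =
    {prod_list w | w. set w \<subseteq> {p, q} \<and> distinct_adj w \<and> length w \<le> l}"


section \<open>Tensor powers\<close>

text \<open>
  \<open>tens a\<close> is the elementary tensor \<open>a 0 \<otimes> \<dots> \<otimes> a (k - 1)\<close> in the C*-algebra \<open>'d\<close>. The locale says
  that \<open>'d\<close> is a C*-completion of the \<open>k\<close>-fold algebraic tensor power of \<open>'a\<close>: \<open>tens_independent\<close>
  states that the induced linear map from the algebraic tensor power to \<open>'d\<close> is injective, and
  \<open>tens_dense\<close> that its image is dense. No particular C*-tensor norm is fixed. The universal
  C*-algebra of two projections is nuclear, so for it there is exactly one such completion.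
\<close>

locale cstar_tensor_power =
  fixes k :: nat and tens :: "(nat \<Rightarrow> 'a::cstar_algebra) \<Rightarrow> 'd::cstar_algebra"
  assumes tens_cong: "(\<And>i. i < k \<Longrightarrow> a i = b i) \<Longrightarrow> tens a = tens b"
    and tens_add: "i < k \<Longrightarrow> tens (a(i := x + y)) = tens (a(i := x)) + tens (a(i := y))"
    and tens_scaleC: "i < k \<Longrightarrow> tens (a(i := c *\<^sub>C x)) = c *\<^sub>C tens (a(i := x))"
    and tens_one: "tens (\<lambda>i. 1) = 1"
    and tens_mult: "tens (\<lambda>i. a i * b i) = tens a * tens b"
    and tens_star: "tens (\<lambda>i. star (a i)) = star (tens a)"
    and tens_independent: "cindependent B \<Longrightarrow>
      inj_on tens ({..<k} \<rightarrow>\<^sub>E B) \<and> cindependent (tens ` ({..<k} \<rightarrow>\<^sub>E B))"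
    and tens_dense: "closure (cspan (range tens)) = UNIV"

definition elementary_tensors ::
    "nat \<Rightarrow> ((nat \<Rightarrow> 'a::cstar_algebra) \<Rightarrow> 'd::cstar_algebra) \<Rightarrow> 'a set \<Rightarrow> 'd set"
  where "elementary_tensors k tens S = {tens a | a. \<forall>i<k. a i \<in> S}"


section \<open>Magic unitaries and separating polynomials\<close>

text \<open>An \<open>n \<times> n\<close> matrix has its rows and columns indexed by a finite type \<open>'n\<close> with \<open>CARD('n) = n\<close>.\<close>

definition magic_unitary :: "'d::cstar_algebra ^ 'n ^ 'n \<Rightarrow> bool"
  where "magic_unitary M \<longleftrightarrow>
    (\<forall>i j. is_projection (M $ i $ j)) \<and>
    (\<forall>i. (\<Sum>r\<in>UNIV. M $ i $ r) = 1) \<and>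
    (\<forall>j. (\<Sum>r\<in>UNIV. M $ r $ j) = 1)"

abbreviation xvar :: "'n \<Rightarrow> 'n \<Rightarrow> ('n \<times> 'n) free_algebra"
  where "xvar i j \<equiv> var (i, j)"

definition magic_relations :: "('n::finite \<times> 'n) free_algebra set"
  where "magic_relations =
    {(xvar i j)\<^sup>2 - xvar i j | i j. True} \<union>
    {(\<Sum>r\<in>UNIV. xvar i r) - 1 | i. True} \<union>
    {(\<Sum>r\<in>UNIV. xvar r j) - 1 | j. True} \<union>
    {xvar i j * xvar i r | i j r. j \<noteq> r} \<union>
    {xvar j i * xvar r i | i j r. j \<noteq> r}"

definition magic_unitary_ideal :: "('n::finite \<times> 'n) free_algebra set"
  where "magic_unitary_ideal = two_sided_ideal hull magic_relations"

definition matrix_subst :: "'d::cstar_algebra ^ 'n ^ 'n \<Rightarrow> ('n \<times> 'n) free_algebra \<Rightarrow> 'd"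
  where "matrix_subst M = subst (\<lambda>(i, j). M $ i $ j)"

definition separating_polynomial ::
    "'d::cstar_algebra ^ 'n ^ 'n \<Rightarrow> ('n \<times> 'n) free_algebra \<Rightarrow> bool"
  where "separating_polynomial M f \<longleftrightarrow>
    f \<noteq> 0 \<and> matrix_subst M f = 0 \<and> f \<notin> magic_unitary_ideal"

end

theory Submission
  imports Defs
begin

text \<open>
  Polynomials of degree \<open>d\<close> in the entries of \<open>M\<close> lie in the span of \<open>(\<A>\<^sub>l\<^sub>d)\<^sup>\<otimes>\<^sup>k\<close>, whose dimension
  grows polynomially in \<open>d\<close>. For \<open>n \<ge> 5\<close>, however, the free algebra modulo the magic unitary ideal
  has exponential growth: the block matrix with the \<open>2 \<times> 2\<close> magic matrix of a projection \<open>P\<close>,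
  the \<open>3 \<times> 3\<close> circulant magic matrix of a partition of unity \<open>E\<^sub>0 + E\<^sub>1 + E\<^sub>2 = 1\<close> and an identity
  block maps it onto the free product \<open>\<complex>\<^sup>2 * \<complex>\<^sup>3\<close>, where the \<open>2\<^sup>m\<close> words of length \<open>m\<close> in \<open>E\<^sub>0P\<close>
  and \<open>E\<^sub>1P\<close> are linearly independent. Some combination of such words therefore vanishes at \<open>M\<close>
  without lying in the ideal.
\<close>

section \<open>Linear extension of evaluations of words\<close>

lemma poly_mapping_sum_single:
  "f = (\<Sum>w\<in>Poly_Mapping.keys f. Poly_Mapping.single w (Poly_Mapping.lookup f w))"
proof (rule poly_mapping_eqI)
  fix k
  have "Poly_Mapping.lookup (\<Sum>w\<in>Poly_Mapping.keys f. Poly_Mapping.single w (Poly_Mapping.lookup f w)) k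
      = (\<Sum>w\<in>Poly_Mapping.keys f. if w = k then Poly_Mapping.lookup f w else 0)"
    by (auto simp: lookup_sum lookup_single when_def intro!: sum.cong)
  then show "Poly_Mapping.lookup f k
      = Poly_Mapping.lookup (\<Sum>w\<in>Poly_Mapping.keys f. Poly_Mapping.single w (Poly_Mapping.lookup f w)) k"
    by (auto simp: in_keys_iff)
qed

lemma poly_mapping_induct_single [case_names single add]:
  fixes f :: "'a \<Rightarrow>\<^sub>0 'b::comm_monoid_add"
  assumes single: "\<And>w c. Q (Poly_Mapping.single w c)"
    and add: "\<And>f g. Q f \<Longrightarrow> Q g \<Longrightarrow> Q (f + g)"
  shows "Q f"
proof -
  have "Q (\<Sum>w\<in>A. Poly_Mapping.single w (c w))" if "finite A" for A and c
    using that
  proof induction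
    case empty
    show ?case using single[of _ 0] by simp
  next
    case (insert x F)
    then show ?case by (simp add: add single)
  qed
  then show ?thesis
    using poly_mapping_sum_single[of f] by (metis finite_keys)
qed

lemma subst_superset:
  assumes "finite K" "Poly_Mapping.keys f \<subseteq> K"
  shows "subst v f = (\<Sum>w\<in>K. Poly_Mapping.lookup f w *\<^sub>C prod_list (map v w))"
  unfolding subst_def using assms
  by (intro sum.mono_neutral_left) (auto simp: in_keys_iff)

lemma subst_single: "subst v (Poly_Mapping.single w c) = c *\<^sub>C prod_list (map v w)"
  by (subst subst_superset[of "{w}"]) auto

lemma subst_zero [simp]: "subst v 0 = 0"
  by (simp add: subst_def)

lemma subst_add: "subst v (f + g) = subst v f + subst v g"
proof -
  let ?K = "Poly_Mapping.keys f \<union> Poly_Mapping.keys g"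
  have "subst v h = (\<Sum>w\<in>?K. Poly_Mapping.lookup h w *\<^sub>C prod_list (map v w))"
    if "Poly_Mapping.keys h \<subseteq> ?K" for h
    using that by (intro subst_superset) auto
  then show ?thesis
    by (simp add: keys_add lookup_add scaleC_add_left sum.distrib)
qed

lemma subst_sum: "subst v (\<Sum>i\<in>I. f i) = (\<Sum>i\<in>I. subst v (f i))"
  by (induction I rule: infinite_finite_induct) (auto simp: subst_add)

section \<open>Action of the free algebra on complex-valued functions\<close>

definition linear_operator :: "(('b \<Rightarrow> complex) \<Rightarrow> 'b \<Rightarrow> complex) \<Rightarrow> bool"
  where "linear_operator S \<longleftrightarrow>
    (\<forall>f g. S (\<lambda>b. f b + g b) = (\<lambda>b. S f b + S g b)) \<and>
    (\<forall>c f. S (\<lambda>b. c * f b) = (\<lambda>b. c * S f b))"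

lemma linear_operator_foldr:
  assumes "\<And>x. linear_operator (T x)"
  shows "linear_operator (foldr T w)"
  using assms by (induction w) (simp_all add: linear_operator_def)

text \<open>The counterpart of \<open>subst\<close> for operators that need not live in a
  C*-algebra: the letters of a word act one after another, the last letter first.\<close>

definition free_action ::
    "('x \<Rightarrow> ('b \<Rightarrow> complex) \<Rightarrow> 'b \<Rightarrow> complex) \<Rightarrow> 'x free_algebra \<Rightarrow> ('b \<Rightarrow> complex) \<Rightarrow> 'b \<Rightarrow> complex"
  where "free_action T f v b =
    (\<Sum>w\<in>Poly_Mapping.keys f. Poly_Mapping.lookup f w * foldr T w v b)"

lemma free_action_superset:
  assumes "finite K" "Poly_Mapping.keys f \<subseteq> K"
  shows "free_action T f v b = (\<Sum>w\<in>K. Poly_Mapping.lookup f w * foldr T w v b)"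
  unfolding free_action_def using assms
  by (intro sum.mono_neutral_left) (auto simp: in_keys_iff)

lemma free_action_single:
  "free_action T (Poly_Mapping.single w c) v = (\<lambda>b. c * foldr T w v b)"
  by (rule ext, subst free_action_superset[of "{w}"]) auto

lemma free_action_var: "free_action T (var x) v = T x v"
  by (simp add: var_def free_action_single)

lemma free_action_zero: "free_action T 0 v = (\<lambda>b. 0)"
  by (simp add: free_action_def fun_eq_iff)

lemma free_action_one: "free_action T 1 v = v"
  by (simp add: free_action_single zero_list_def flip: single_one)

lemma free_action_add:
  "free_action T (f + g) v = (\<lambda>b. free_action T f v b + free_action T g v b)"
proof
  fix b
  let ?K = "Poly_Mapping.keys f \<union> Poly_Mapping.keys g"
  have "free_action T h v b = (\<Sum>w\<in>?K. Poly_Mapping.lookup h w * foldr T w v b)"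
    if "Poly_Mapping.keys h \<subseteq> ?K" for h
    using that by (intro free_action_superset) auto
  then show "free_action T (f + g) v b = free_action T f v b + free_action T g v b"
    by (simp add: keys_add lookup_add distrib_right sum.distrib)
qed

lemma free_action_diff:
  "free_action T (f - g) v = (\<lambda>b. free_action T f v b - free_action T g v b)"
  using free_action_add[of T "f - g" g v] by (auto simp: fun_eq_iff)

lemma free_action_sum:
  "free_action T (\<Sum>i\<in>I. f i) v = (\<lambda>b. \<Sum>i\<in>I. free_action T (f i) v b)"
  by (induction I rule: infinite_finite_induct) (auto simp: free_action_add free_action_zero)

lemma linear_operator_free_action:
  assumes "\<And>x. linear_operator (T x)"
  shows "linear_operator (free_action T f)"
  using linear_operator_foldr[of T, OF assms]
  by (simp add: linear_operator_def free_action_def fun_eq_iff sum.distrib distrib_left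
      sum_distrib_left mult.left_commute)

text \<open>Concatenated words act by composition; linearity of the \<open>T x\<close> carries the
  scalars and sums of the right factor through the left one.\<close>

lemma free_action_mult:
  assumes "\<And>x. linear_operator (T x)"
  shows "free_action T (f * g) v = free_action T f (free_action T g v)"
proof (induction f rule: poly_mapping_induct_single)
  case (single u c)
  show ?case
  proof (induction g rule: poly_mapping_induct_single)
    case (single w d)
    show ?case
      using linear_operator_foldr[of T u, OF assms]
      by (simp add: mult_single free_action_single plus_list_def linear_operator_def mult.assoc)
  next
    case (add a b)
    then show ?case
      using linear_operator_free_action[of T, OF assms]
      by (simp add: distrib_left free_action_add linear_operator_def)
  qed
next
  case (add a b)
  then show ?case by (simp add: distrib_right free_action_add)
qed

text \<open>The elements acting as zero on every vector form a two-sided ideal. Once it contains the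
  relations, a single non-zero value of the action certifies that a polynomial is outside the magic
  unitary ideal.\<close>

lemma free_action_magic_unitary_ideal:
  assumes lin: "\<And>x. linear_operator (T x)"
    and idem: "\<And>i j v. T (i, j) (T (i, j) v) = T (i, j) v"
    and row_orth: "\<And>i j r v. j \<noteq> r \<Longrightarrow> T (i, j) (T (i, r) v) = (\<lambda>b. 0)"
    and col_orth: "\<And>i j r v. j \<noteq> r \<Longrightarrow> T (j, i) (T (r, i) v) = (\<lambda>b. 0)"
    and row_sum: "\<And>i v b. (\<Sum>r\<in>UNIV. T (i, r) v b) = v b"
    and col_sum: "\<And>j v b. (\<Sum>r\<in>UNIV. T (r, j) v b) = v b"
    and f: "f \<in> magic_unitary_ideal"
  shows "free_action T f v = (\<lambda>b. 0)"
proof -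
  let ?J = "{f. \<forall>v. free_action T f v = (\<lambda>b. 0)}"
  \<comment> \<open>Handles left multiples: \<open>a * x\<close> applies the operator of
    \<open>a\<close> to the zero function.\<close>
  have zero: "free_action T g (\<lambda>b. 0) = (\<lambda>b. 0)" for g
  proof -
    have "\<forall>c f. free_action T g (\<lambda>b. c * f b) = (\<lambda>b. c * free_action T g f b)"
      using linear_operator_free_action[of T g, OF lin] by (simp add: linear_operator_def)
    from this[rule_format, of 0] show ?thesis by simp
  qed
  have "two_sided_ideal ?J"
    unfolding two_sided_ideal_def mem_Collect_eq Ball_def
    by (simp add: free_action_zero free_action_add free_action_mult[OF lin] zero)
  moreover have "magic_relations \<subseteq> ?J"
  proof
    note [simp] = free_action_diff free_action_sum free_action_one free_action_var
      free_action_mult[OF lin] power2_eq_square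
    fix x :: "('a \<times> 'a) free_algebra" assume "x \<in> magic_relations"
    then consider i j where "x = (xvar i j)\<^sup>2 - xvar i j"
      | i where "x = (\<Sum>r\<in>UNIV. xvar i r) - 1"
      | j where "x = (\<Sum>r\<in>UNIV. xvar r j) - 1"
      | i j r where "x = xvar i j * xvar i r" "j \<noteq> r"
      | i j r where "x = xvar j i * xvar r i" "j \<noteq> r"
      unfolding magic_relations_def by blast
    then show "x \<in> ?J"
      by cases (simp_all add: idem row_orth col_orth row_sum col_sum)
  qed
  ultimately have "magic_unitary_ideal \<subseteq> ?J"
    unfolding magic_unitary_ideal_def by (intro hull_minimal)
  then show ?thesis using f by auto
qed


section \<open>A magic matrix of operators generating a free algebra\<close>

text \<open>
  \<open>\<complex>\<^sup>2 * \<complex>\<^sup>3\<close> acts on the span of its alternating words that end in \<open>P\<close>: \<open>(None, [i, j, \<dots>])\<close> is the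
  word \<open>P E\<^sub>i P E\<^sub>j P \<dots> P\<close> and \<open>(Some r, w)\<close> is \<open>E\<^sub>r\<close> times the word \<open>(None, w)\<close>, where \<open>E\<^bsub>True\<^esub>\<close>
  and \<open>E\<^bsub>False\<^esub>\<close> are two members of the partition of unity. The operators below are the transposes
  of this action, so they act on arbitrary functions of words.
\<close>

definition proj_op :: "(bool option \<times> bool list \<Rightarrow> complex) \<Rightarrow> bool option \<times> bool list \<Rightarrow> complex"
  where "proj_op v = (\<lambda>(x, w). v (None, case x of None \<Rightarrow> w | Some i \<Rightarrow> i # w))"

definition basic_op ::
    "bool \<Rightarrow> (bool option \<times> bool list \<Rightarrow> complex) \<Rightarrow> bool option \<times> bool list \<Rightarrow> complex"
  where "basic_op i v = (\<lambda>(x, w). if x = None \<or> x = Some i then v (Some i, w) else 0)"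

definition part_op ::
    "nat \<Rightarrow> (bool option \<times> bool list \<Rightarrow> complex) \<Rightarrow> bool option \<times> bool list \<Rightarrow> complex"
  where "part_op t v =
    (if t = 0 then basic_op True v else if t = 1 then basic_op False v
     else (\<lambda>b. v b - basic_op True v b - basic_op False v b))"

text \<open>
  Indexing the \<open>3 \<times> 3\<close> block by the symmetric Latin square \<open>(r + s) mod 3\<close> makes the whole matrix
  symmetric, so that the column relations follow from the row relations.
\<close>

definition block_op ::
    "nat \<Rightarrow> nat \<Rightarrow> (bool option \<times> bool list \<Rightarrow> complex) \<Rightarrow> bool option \<times> bool list \<Rightarrow> complex"
  where "block_op r s v =
    (if r < 2 \<and> s < 2 then (if r = s then proj_op v else (\<lambda>b. v b - proj_op v b))
     else if 2 \<le> r \<and> r < 5 \<and> 2 \<le> s \<and> s < 5 then part_op ((r + s) mod 3) v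
     else if r = s then v else (\<lambda>b. 0))"

section \<open>The magic relations for the block matrix\<close>

lemma proj_op_idem: "proj_op (proj_op v) = proj_op v"
  by (auto simp: proj_op_def fun_eq_iff)

lemma linear_operator_proj_op: "linear_operator proj_op"
  by (auto simp: linear_operator_def proj_op_def fun_eq_iff)

lemma linear_operator_part_op: "linear_operator (part_op t)"
  by (auto simp: linear_operator_def part_op_def basic_op_def fun_eq_iff algebra_simps)

lemma basic_op_basic_op:
  "basic_op i (basic_op j v) = (if i = j then basic_op i v else (\<lambda>b. 0))"
  by (auto simp: basic_op_def fun_eq_iff)

lemma basic_op_complement:
  "basic_op i (\<lambda>b. v b - basic_op True v b - basic_op False v b) = (\<lambda>b. 0)"
  by (cases i) (auto simp: basic_op_def fun_eq_iff)

lemma part_op_idem: "part_op t (part_op t v) = part_op t v"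
  by (simp add: part_op_def basic_op_basic_op basic_op_complement)

lemma part_op_orth:
  assumes "t \<noteq> t'" "t < 3" "t' < 3"
  shows "part_op t (part_op t' v) = (\<lambda>b. 0)"
proof -
  have zero: "basic_op i (\<lambda>b. 0) = (\<lambda>b. 0)" for i
    by (auto simp: basic_op_def fun_eq_iff)
  have t: "t \<in> {0, 1, 2}" using assms(2) by auto
  have t': "t' \<in> {0, 1, 2}" using assms(3) by auto
  from t t' assms(1) show ?thesis
    by (elim insertE emptyE)
      (simp_all add: part_op_def basic_op_basic_op basic_op_complement zero)
qed

lemma linear_operator_block_op: "linear_operator (block_op r s)"
proof -
  have compl: "linear_operator (\<lambda>v b. v b - proj_op v b)"
    using linear_operator_proj_op by (simp add: linear_operator_def fun_eq_iff right_diff_distrib)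
  have trivial: "linear_operator (\<lambda>v. v)" "linear_operator (\<lambda>v b. 0)"
    by (simp_all add: linear_operator_def)
  have "block_op r s =
      (if r < 2 \<and> s < 2 then (if r = s then proj_op else (\<lambda>v b. v b - proj_op v b))
       else if 2 \<le> r \<and> r < 5 \<and> 2 \<le> s \<and> s < 5 then part_op ((r + s) mod 3)
       else if r = s then (\<lambda>v. v) else (\<lambda>v b. 0))"
    by (rule ext) (simp only: block_op_def split: if_split, blast)
  then show ?thesis
    by (simp only: linear_operator_proj_op linear_operator_part_op compl trivial split: if_split) simp
qed

lemma block_op_commute: "block_op r s = block_op s r"
  by (auto simp: block_op_def fun_eq_iff add.commute)

lemma block_op_idem: "block_op r s (block_op r s v) = block_op r s v"
proof -
  have "proj_op (\<lambda>b. v b - proj_op v b) = (\<lambda>b. 0)"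
    by (auto simp: proj_op_def fun_eq_iff)
  then show ?thesis
    by (simp add: block_op_def proj_op_idem part_op_idem)
qed

lemma block_op_orth:
  assumes "s \<noteq> s'"
  shows "block_op r s (block_op r s' v) = (\<lambda>b. 0)"
proof -
  have proj: "proj_op (\<lambda>b. v b - proj_op v b) = (\<lambda>b. 0)"
    by (auto simp: proj_op_def fun_eq_iff)
  have zero: "proj_op (\<lambda>b. 0) = (\<lambda>b. 0)" "part_op t (\<lambda>b. 0) = (\<lambda>b. 0)" for t
    by (auto simp: proj_op_def part_op_def basic_op_def fun_eq_iff)
  have part: "part_op ((r + s) mod 3) (part_op ((r + s') mod 3) v) = (\<lambda>b. 0)"
    if "2 \<le> r" "r < 5" "2 \<le> s" "s < 5" "2 \<le> s'" "s' < 5"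
  proof (rule part_op_orth)
    \<comment> \<open>A row of the Latin square has no repeated entry; the finitely many cases are
      inspected.\<close>
    have "r \<in> {2, 3, 4}" "s \<in> {2, 3, 4}" "s' \<in> {2, 3, 4}" using that by auto
    then show "(r + s) mod 3 \<noteq> (r + s') mod 3"
      using assms by (elim insertE emptyE) simp_all
  qed auto
  consider "r < 2" | "2 \<le> r" "r < 5" | "5 \<le> r" by linarith
  then show ?thesis
  proof cases
    case 1
    then show ?thesis
      using assms by (auto simp: block_op_def proj_op_idem proj zero)
  next
    case 2
    then show ?thesis
      using part by (auto simp: block_op_def zero)
  next
    case 3
    then show ?thesis
      using assms by (auto simp: block_op_def)
  qed
qed

lemma block_op_sum:
  assumes "r < n" "5 \<le> n"
  shows "(\<Sum>s<n. block_op r s v b) = v b"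
proof -
  \<comment> \<open>The first five columns hold the two non-trivial blocks, the remaining ones the
    identity block; each row meets only one block.\<close>
  have "{..<n} = {0,1,2,3,4} \<union> {5..<n}" using assms by auto
  then have "(\<Sum>s<n. block_op r s v b)
      = (\<Sum>s\<in>{0,1,2,3,4}. block_op r s v b) + (\<Sum>s=5..<n. block_op r s v b)"
    by (simp only:) (rule sum.union_disjoint, auto)
  also have "(\<Sum>s=5..<n. block_op r s v b) = (\<Sum>s=5..<n. if s = r then v b else 0)"
    by (intro sum.cong) (auto simp: block_op_def)
  also have "\<dots> = (if 5 \<le> r then v b else 0)"
    using assms by simp
  also have "(\<Sum>s\<in>{0,1,2,3,4}. block_op r s v b) = (if 5 \<le> r then 0 else v b)"
  proof -
    have "r = 0 \<or> r = 1 \<or> r = 2 \<or> r = 3 \<or> r = 4 \<or> 5 \<le> r" by linarith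
    then show ?thesis
      by (elim disjE) (simp_all add: block_op_def part_op_def)
  qed
  finally show ?thesis by simp
qed

text \<open>Encodes a product of factors \<open>E_i P\<close>: position (0, 0) holds
  \<open>P\<close>; in the Latin square 2 + 4 is 0 modulo 3, the index of
  \<open>basic_op True\<close>, and 2 + 2 is 1, that of \<open>basic_op False\<close>.\<close>

definition free_word :: "(nat \<Rightarrow> 'n) \<Rightarrow> bool list \<Rightarrow> ('n \<times> 'n) list"
  where "free_word g u = concat (map (\<lambda>i. [(g 2, g (if i then 4 else 2)), (g 0, g 0)]) u)"

lemma length_free_word: "length (free_word g u) = 2 * length u"
  by (induction u) (simp_all add: free_word_def)

text \<open>Transposed operators compose in reverse order: the first letter of \<open>u\<close> is
  the first to be put in front of \<open>w\<close> and ends up next to it.\<close>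

lemma foldr_free_word:
  assumes "\<And>r. r < 5 \<Longrightarrow> h (g r) = r"
  shows "foldr (\<lambda>(i, j). block_op (h i) (h j)) (free_word g u) v (None, w) = v (None, rev u @ w)"
proof (induction u arbitrary: w)
  case Nil
  then show ?case by (simp add: free_word_def)
next
  case (Cons i u)
  then show ?case
    by (cases i) (simp_all add: free_word_def assms block_op_def part_op_def basic_op_def proj_op_def)
qed

text \<open>Independence modulo the ideal: distinct \<open>u\<close> move the base point
  \<open>(None, [])\<close> to distinct points, so no non-trivial combination acts as zero.\<close>

lemma free_words_independent:
  assumes "CARD('n) \<ge> 5"
  obtains g :: "nat \<Rightarrow> 'n::finite" where
    "\<And>U c u. finite U \<Longrightarrow> u \<in> U \<Longrightarrow> c u \<noteq> 0 \<Longrightarrow>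
      (\<Sum>u\<in>U. Poly_Mapping.single (free_word g u) (c u :: complex)) \<notin> magic_unitary_ideal"
proof -
  obtain h :: "'n \<Rightarrow> nat" where h: "bij_betw h UNIV {..<CARD('n)}"
    using ex_bij_betw_finite_nat[of "UNIV :: 'n set"] by (auto simp: atLeast0LessThan)
  then have inj: "h i = h j \<longleftrightarrow> i = j" for i j
    by (auto simp: bij_betw_def inj_on_def)
  have less: "h i < CARD('n)" for i
    using h by (auto simp: bij_betw_def)
  define g where "g = inv h"
  have hg: "h (g r) = r" if "r < 5" for r
    using h that assms unfolding g_def bij_betw_def by (intro f_inv_into_f) auto
  define T where "T = (\<lambda>(i, j). block_op (h i) (h j))"
  have sum: "(\<Sum>j\<in>UNIV. block_op (h i) (h j) v b) = v b" for i v b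
    using sum.reindex_bij_betw[OF h, of "\<lambda>s. block_op (h i) s v b"] block_op_sum[OF less assms]
    by simp
  have vanish: "free_action T f v = (\<lambda>b. 0)" if "f \<in> magic_unitary_ideal" for f v
  proof (rule free_action_magic_unitary_ideal[OF _ _ _ _ _ _ that])
    show "linear_operator (T x)" for x
      by (cases x) (simp add: T_def linear_operator_block_op)
    show "T (i, j) (T (i, j) v) = T (i, j) v" for i j v
      by (simp add: T_def block_op_idem)
    show "T (i, j) (T (i, r) v) = (\<lambda>b. 0)" if "j \<noteq> r" for i j r v
      using that by (simp add: T_def block_op_orth inj)
    show "T (j, i) (T (r, i) v) = (\<lambda>b. 0)" if "j \<noteq> r" for i j r v
      using that by (simp add: T_def block_op_orth inj block_op_commute[of _ "h i"])
    show "(\<Sum>r\<in>UNIV. T (i, r) v b) = v b" for i v b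
      by (simp add: T_def sum)
    show "(\<Sum>r\<in>UNIV. T (r, j) v b) = v b" for j v b
      by (simp add: T_def sum block_op_commute[of _ "h j"])
  qed
  show thesis
  proof (rule that[of g], rule notI)
    fix U and c :: "bool list \<Rightarrow> complex" and u
    assume U: "finite U" "u \<in> U" "c u \<noteq> 0"
      and ideal: "(\<Sum>u\<in>U. Poly_Mapping.single (free_word g u) (c u)) \<in> magic_unitary_ideal"
    \<comment> \<open>Dual to the chosen \<open>u\<close>: evaluating the action on \<open>v\<close>
      at \<open>(None, [])\<close> reads off the coefficient \<open>c u\<close>.\<close>
    define v :: "bool option \<times> bool list \<Rightarrow> complex"
      where "v = (\<lambda>(x, w). if w = rev u then 1 else 0)"
    have word: "foldr T (free_word g u') v (None, []) = v (None, rev u')" for u'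
      using foldr_free_word[of h g u' v "[]"] hg by (simp add: T_def)
    have "free_action T (\<Sum>u\<in>U. Poly_Mapping.single (free_word g u) (c u)) v (None, [])
        = (\<Sum>u'\<in>U. c u' * v (None, rev u'))"
      by (simp only: free_action_sum free_action_single word)
    also have "\<dots> = (\<Sum>u'\<in>U. if u' = u then c u' else 0)"
      by (intro sum.cong) (auto simp: v_def)
    also have "\<dots> = c u"
      by (simp only: sum.delta[OF U(1)] U(2) if_True)
    finally have "c u = 0"
      by (simp only: vanish[OF ideal])
    with U(3) show False by contradiction
  qed
qed


section \<open>Polynomial growth of products of tensors\<close>

lemma prod_list_remdups_adj:
  fixes w :: "'a::monoid_mult list"
  assumes "\<And>x. x \<in> set w \<Longrightarrow> x * x = x"
  shows "prod_list (remdups_adj w) = prod_list w"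
  using assms
proof (induction w rule: remdups_adj.induct)
  case (3 x y xs)
  show ?case
  proof (cases "x = y")
    case True
    have "x * (x * prod_list xs) = x * prod_list xs"
      using 3(3)[of x] by (simp only: mult.assoc[symmetric]) simp
    then show ?thesis using True 3 by simp
  next
    case False
    then show ?thesis using 3 by simp
  qed
qed simp_all

text \<open>Collapsing adjacent equal idempotents makes any word in \<open>p\<close> and
  \<open>q\<close> alternating, keeps its product and never lengthens it.\<close>

lemma alternating_productsI:
  assumes "p * p = p" "q * q = q" "set w \<subseteq> {p, q}" "length w \<le> l"
  shows "prod_list w \<in> alternating_products p q l"
proof -
  have "prod_list (remdups_adj w) = prod_list w"
    using assms by (intro prod_list_remdups_adj) auto
  then show ?thesis
    using assms le_trans[OF remdups_adj_length assms(4)]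
    unfolding alternating_products_def
    by (intro CollectI exI[of _ "remdups_adj w"]) auto
qed

lemma alternating_products_mult:
  assumes "p * p = p" "q * q = q"
    and "x \<in> alternating_products p q l" "y \<in> alternating_products p q m"
  shows "x * y \<in> alternating_products p q (l + m)"
proof -
  obtain u w where "x = prod_list u" "y = prod_list w" "set u \<subseteq> {p, q}" "set w \<subseteq> {p, q}"
    "length u \<le> l" "length w \<le> m"
    using assms unfolding alternating_products_def by auto
  then show ?thesis
    using alternating_productsI[OF assms(1,2), of "u @ w" "l + m"] by simp
qed

primrec alternating_word :: "'a \<Rightarrow> 'a \<Rightarrow> nat \<Rightarrow> 'a list" where
  "alternating_word x y 0 = []"
| "alternating_word x y (Suc n) = x # alternating_word y x n"

lemma distinct_adj_alternating_word:
  assumes "distinct_adj w" "set w \<subseteq> {x, y}"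
  shows "w = alternating_word x y (length w) \<or> w = alternating_word y x (length w)"
  using assms
proof (induction w)
  case (Cons a w)
  then show ?case
    by (cases w) (auto simp: distinct_adj_Cons)
qed simp

text \<open>An alternating word is fixed by its first letter and its length, so the count is linear
  in \<open>l\<close>. This is the source of polynomial growth.\<close>

lemma finite_card_alternating_products:
  "finite (alternating_products p q l) \<and> card (alternating_products p q l) \<le> 2 * (l + 1)"
proof -
  let ?w = "\<lambda>(b, n). prod_list (if b then alternating_word p q n else alternating_word q p n)"
  have "alternating_products p q l \<subseteq> ?w ` (UNIV \<times> {..l})"
  proof
    fix x assume "x \<in> alternating_products p q l"
    then obtain w where w: "x = prod_list w" "set w \<subseteq> {p, q}" "distinct_adj w" "length w \<le> l"
      by (auto simp: alternating_products_def)
    from distinct_adj_alternating_word[OF w(3,2)] show "x \<in> ?w ` (UNIV \<times> {..l})"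
    proof
      assume "w = alternating_word p q (length w)"
      then show ?thesis using w by (intro image_eqI[of _ _ "(True, length w)"]) auto
    next
      assume "w = alternating_word q p (length w)"
      then show ?thesis using w by (intro image_eqI[of _ _ "(False, length w)"]) auto
    qed
  qed
  moreover have "card (?w ` (UNIV \<times> {..l})) \<le> 2 * (l + 1)"
    by (rule order.trans[OF card_image_le]) (auto simp: card_cartesian_product)
  ultimately show ?thesis
    by (meson card_mono finite_SigmaI finite_atMost finite_class.finite_UNIV finite_imageI
        finite_subset le_trans)
qed

section \<open>Counting and multiplying elementary tensors\<close>

context cstar_tensor_power
begin

lemma finite_card_elementary_tensors:
  assumes "finite S"
  shows "finite (elementary_tensors k tens S) \<and> card (elementary_tensors k tens S) \<le> card S ^ k"
proof -
  have "elementary_tensors k tens S \<subseteq> tens ` ({..<k} \<rightarrow>\<^sub>E S)"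
  proof
    fix x assume "x \<in> elementary_tensors k tens S"
    then obtain a where a: "x = tens a" "\<forall>i<k. a i \<in> S"
      by (auto simp: elementary_tensors_def)
    \<comment> \<open>Only the first \<open>k\<close> arguments matter, so \<open>a\<close> may be
      taken extensional; there are \<open>card S ^ k\<close> such functions.\<close>
    have "tens a = tens (restrict a {..<k})"
      by (rule tens_cong) simp
    then show "x \<in> tens ` ({..<k} \<rightarrow>\<^sub>E S)"
      using a by (intro image_eqI[of _ _ "restrict a {..<k}"]) auto
  qed
  moreover have fin: "finite ({..<k} \<rightarrow>\<^sub>E S)"
    using assms by (intro finite_PiE) auto
  moreover have "card (tens ` ({..<k} \<rightarrow>\<^sub>E S)) \<le> card S ^ k"
    using card_image_le[OF fin, of tens] by (simp add: card_PiE)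
  ultimately show ?thesis
    by (meson card_mono finite_imageI finite_subset le_trans)
qed

lemma cspan_elementary_tensors_mult:
  assumes mult: "\<And>x y. x \<in> S \<Longrightarrow> y \<in> S' \<Longrightarrow> x * y \<in> S''"
    and "a \<in> cspan (elementary_tensors k tens S)" "b \<in> cspan (elementary_tensors k tens S')"
  shows "a * b \<in> cspan (elementary_tensors k tens S'')"
proof -
  have gen: "x * y \<in> cspan (elementary_tensors k tens S'')"
    if "x \<in> elementary_tensors k tens S" "y \<in> elementary_tensors k tens S'" for x y
  proof -
    obtain a b where "x = tens a" "\<forall>i<k. a i \<in> S" "y = tens b" "\<forall>i<k. b i \<in> S'"
      using \<open>x \<in> _\<close> \<open>y \<in> _\<close> by (auto simp: elementary_tensors_def)
    then have "x * y \<in> elementary_tensors k tens S''"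
      unfolding elementary_tensors_def using mult tens_mult[of a b]
      by (intro CollectI exI[of _ "\<lambda>i. a i * b i"]) auto
    then show ?thesis by (rule cstar_vs.span_base)
  qed
  have "x * b \<in> cspan (elementary_tensors k tens S'')" if "x \<in> elementary_tensors k tens S" for x
    using assms(3)
    by (induction rule: cstar_vs.span_induct_alt)
      (auto simp: distrib_left mult_scaleC_right that
        intro!: cstar_vs.span_add cstar_vs.span_scale gen cstar_vs.span_zero)
  with assms(2) show ?thesis
    by (induction rule: cstar_vs.span_induct_alt)
      (auto simp: distrib_right mult_scaleC_left
        intro!: cstar_vs.span_add cstar_vs.span_scale cstar_vs.span_zero)
qed

text \<open>Each factor adds at most \<open>l\<close> letters in every tensor slot, while the number
  of slots stays \<open>k\<close>.\<close>

lemma prod_list_cspan_elementary_tensors: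
  assumes idem: "p * p = p" "q * q = q"
    and "set w \<subseteq> cspan (elementary_tensors k tens (alternating_products p q l))"
  shows "prod_list w \<in> cspan (elementary_tensors k tens (alternating_products p q (l * length w)))"
  using assms(3)
proof (induction w)
  case Nil
  have "1 \<in> elementary_tensors k tens (alternating_products p q 0)"
    unfolding elementary_tensors_def alternating_products_def
    using tens_one by (intro CollectI exI[of _ "\<lambda>i. 1"]) auto
  then show ?case by (simp add: cstar_vs.span_base)
next
  case (Cons x w)
  have "x * prod_list w
      \<in> cspan (elementary_tensors k tens (alternating_products p q (l + l * length w)))"
    using Cons by (intro cspan_elementary_tensors_mult alternating_products_mult[OF idem]) auto
  then show ?case by simp
qed

end

lemma universal_two_projections_idem:
  assumes "universal_two_projections p q"
  shows "p * p = p" "q * q = q"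
proof -
  have "case_pq p q g * case_pq p q g = case_pq p q g" for g
  proof -
    let ?x = "Gen g"
    have "(var ?x)\<^sup>2 - var ?x \<in> projection_relations"
      unfolding projection_relations_def by auto
    then have "star_subst (case_pq p q) ((var ?x)\<^sup>2 - var ?x) = 0"
      using assms unfolding universal_two_projections_def universal_cstar_algebra_def by blast
    \<comment> \<open>Expanded into monomials so that evaluation can proceed term by term.\<close>
    moreover have "(var ?x)\<^sup>2 - var ?x
        = Poly_Mapping.single [?x, ?x] 1 + Poly_Mapping.single [?x] (- 1)"
      by (simp add: var_def power2_eq_square mult_single plus_list_def single_uminus)
    ultimately show ?thesis
      by (simp add: star_subst_def subst_add subst_single)
  qed
  from this[of Gen_p] this[of Gen_q] show "p * p = p" "q * q = q" by simp_all
qed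


section \<open>Comparison of growth\<close>

text \<open>Dependence is a property of sets, so a family with a repeated value is treated apart:
  its relation has coefficients 1 and -1 at two indices with equal values.\<close>

lemma (in vector_space) ex_relation_of_card_less:
  assumes "finite U" "finite B" "\<phi> ` U \<subseteq> span B" "card B < card U"
  obtains c where "\<exists>u\<in>U. c u \<noteq> 0" "(\<Sum>u\<in>U. scale (c u) (\<phi> u)) = 0"
proof (cases "inj_on \<phi> U")
  case True
  then have "card B < card (\<phi> ` U)"
    using assms by (simp add: card_image)
  then have "dependent (\<phi> ` U)"
    using independent_span_bound[OF assms(2) _ assms(3)] by force
  then obtain c where "\<exists>x\<in>\<phi> ` U. c x \<noteq> 0" "(\<Sum>x\<in>\<phi> ` U. scale (c x) x) = 0"
    using assms(1) by (auto simp: dependent_finite)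
  then show ?thesis
    using True by (intro that[of "c \<circ> \<phi>"]) (auto simp: sum.reindex)
next
  case False
  then obtain x y where xy: "x \<in> U" "y \<in> U" "x \<noteq> y" "\<phi> x = \<phi> y"
    by (auto simp: inj_on_def)
  define c where "c = (\<lambda>u. if u = x then 1 else if u = y then - 1 else 0 :: 'a)"
  have "(\<Sum>u\<in>U. scale (c u) (\<phi> u)) = (\<Sum>u\<in>{x, y}. scale (c u) (\<phi> u))"
    using xy assms(1) by (intro sum.mono_neutral_right) (auto simp: c_def)
  also have "\<dots> = 0"
    using xy by (simp add: c_def)
  finally show ?thesis
    using xy by (intro that[of c]) (auto simp: c_def)
qed

lemma ex_power_gt_polynomial:
  fixes a k :: nat
  shows "\<exists>m. (a * m + 2) ^ k < 2 ^ m"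
proof -
  \<comment> \<open>The exponent will be \<open>t * Suc k\<close>: then
    \<open>2 ^ (t * Suc k)\<close> has one factor \<open>2 ^ t\<close> more than
    \<open>(2 ^ t) ^ k\<close>, and the base becomes \<open>c * t + 2\<close>. It remains to achieve
    \<open>c * t + 2 < 2 ^ t\<close>.\<close>
  define c where "c = a * Suc k"
  \<comment> \<open>With \<open>t = 2 * s\<close>, \<open>2 ^ t\<close> is at least
    \<open>(s + 1)\<^sup>2\<close>, whereas \<open>c * t = 2 * c * s\<close> and
    \<open>2 * c < s\<close>.\<close>
  define s where "s = 2 * c + 2"
  define t where "t = 2 * s"
  have "c * t + 2 < (s + 1) * (s + 1)"
    by (simp add: t_def s_def algebra_simps)
  also have "s + 1 \<le> 2 ^ s"
    using Suc_leI[OF less_exp[of s]] by simp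
  then have "(s + 1) * (s + 1) \<le> 2 ^ t"
    unfolding t_def mult_2 power_add by (intro mult_mono) auto
  finally have "c * t + 2 < 2 ^ t" .
  then have "(c * t + 2) ^ k \<le> (2 ^ t) ^ k"
    by (intro power_mono) auto
  also have "\<dots> < 2 ^ t * (2 ^ t) ^ k"
  proof -
    have "(1 :: nat) < 2 ^ t" by (rule one_less_power) (simp_all add: t_def s_def)
    then show ?thesis by simp
  qed
  also have "\<dots> = 2 ^ (t * Suc k)"
    by (simp only: power_mult power_Suc)
  also have "c * t = a * (t * Suc k)"
    by (simp only: c_def mult.assoc mult.commute[of "Suc k"])
  finally have "(a * (t * Suc k) + 2) ^ k < 2 ^ (t * Suc k)" .
  then show ?thesis by blast
qed

theorem proposition6p3:
  fixes p q :: "'a::cstar_algebra"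
    and k l :: nat
    and tens :: "(nat \<Rightarrow> 'a) \<Rightarrow> 'd::cstar_algebra"
    and M :: "'d ^ 'n ^ 'n"
  assumes "CARD('n) \<in> {5, 6}"
    and "universal_two_projections p q"
    and "cstar_tensor_power k tens"
    and "magic_unitary M"
    and "\<And>i j. M $ i $ j \<in> cspan (elementary_tensors k tens (alternating_products p q l))"
  shows "\<exists>f. separating_polynomial M f"
proof -
  interpret cstar_tensor_power k tens by (rule assms)
  note idem = universal_two_projections_idem[OF assms(2)]
  have "CARD('n) \<ge> 5" using assms(1) by auto
  then obtain g :: "nat \<Rightarrow> 'n" where g: "\<And>U c u. finite U \<Longrightarrow> u \<in> U \<Longrightarrow> c u \<noteq> 0 \<Longrightarrow>
      (\<Sum>u\<in>U. Poly_Mapping.single (free_word g u) (c u)) \<notin> magic_unitary_ideal"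
    by (rule free_words_independent) blast
  \<comment> \<open>A word of \<open>m\<close> blocks has \<open>2 * m\<close> variables, hence at
    most \<open>2 * l * m\<close> letters per slot; the bound 2 (2lm + 1) = 4lm + 2 on alternating
    products gives the left side, and there are \<open>2 ^ m\<close> such words.\<close>
  obtain m where m: "(4 * l * m + 2) ^ k < 2 ^ m"
    using ex_power_gt_polynomial by blast
  define U where "U = {u. set u \<subseteq> (UNIV :: bool set) \<and> length u = m}"
  define S where "S = alternating_products p q (l * (2 * m))"
  define B where "B = elementary_tensors k tens S"
  define \<phi> where "\<phi> u = prod_list (map (\<lambda>(i, j). M $ i $ j) (free_word g u))" for u
  have U: "finite U" "card U = 2 ^ m"
    unfolding U_def by (rule finite_lists_length_eq, simp) (subst card_lists_length_eq, simp_all)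
  have S: "finite S" "card S \<le> 4 * l * m + 2"
    using finite_card_alternating_products[of p q "l * (2 * m)"] by (simp_all add: S_def)
  have B: "finite B" "card B \<le> card S ^ k"
    using finite_card_elementary_tensors[OF S(1)] by (simp_all add: B_def)
  have "card B < card U"
    using B(2) power_mono[OF S(2), of k] m U(2) by simp
  moreover have "\<phi> ` U \<subseteq> cspan B"
  proof safe
    fix u assume "u \<in> U"
    then have "length (free_word g u) = 2 * m" by (simp add: U_def length_free_word)
    moreover have "set (map (\<lambda>(i, j). M $ i $ j) (free_word g u))
        \<subseteq> cspan (elementary_tensors k tens (alternating_products p q l))"
      using assms(5) by auto
    ultimately show "\<phi> u \<in> cspan B"
      using prod_list_cspan_elementary_tensors[OF idem,
          of "map (\<lambda>(i, j). M $ i $ j) (free_word g u)" l]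
      by (simp only: \<phi>_def B_def S_def length_map)
  qed
  ultimately obtain c where c: "\<exists>u\<in>U. c u \<noteq> 0" "(\<Sum>u\<in>U. c u *\<^sub>C \<phi> u) = 0"
    using cstar_vs.ex_relation_of_card_less[OF U(1) B(1)] by blast
  define f where "f = (\<Sum>u\<in>U. Poly_Mapping.single (free_word g u) (c u))"
  have "f \<notin> magic_unitary_ideal"
    using g[OF U(1)] c(1) unfolding f_def by blast
  \<comment> \<open>Being outside an ideal that contains 0 also makes \<open>f\<close>
    non-zero.\<close>
  moreover have "0 \<in> (magic_unitary_ideal :: ('n \<times> 'n) free_algebra set)"
    by (simp add: magic_unitary_ideal_def hull_def two_sided_ideal_def)
  moreover have "matrix_subst M f = 0"
    unfolding matrix_subst_def f_def subst_sum subst_single \<phi>_def[symmetric] by (rule c(2))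
  ultimately show ?thesis
    unfolding separating_polynomial_def by metis
qed

end
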